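(* Let $n\ge 2$ be an integer and $u>0$ a real number. Suppose $\Theta=(\Theta_1,\ldots,\Theta_n)$ is uniformly distributed on $\Delta^{n,u}$, and let $b$ be a real number with $\frac{u}{n}<b\le u$. Then $$\mathbb{P}(\max(\Theta)\le b)=\frac{1}{u^{n-1}}\sum_{k=0}^{m}\binom{n}{k}(-1)^k\big((n-k)b-u\big)^{n-1},$$ where $m$ is the integer with $0\le m\le n-2$ such that $\frac{u}{n-m}<b\le\frac{u}{n-m-1}$.
   Context: For an integer $n$ and real $u>0$, the $n$-simplex of size $u$ is $\Delta^{n,u}=\{(\theta_1,\ldots,\theta_n)\in\mathbb{R}^n : \theta_1+\cdots+\theta_n=u,\ \theta_i\ge 0 \text{ for } 1\le i\le n\}$. A random vector $\Theta$ is uniformly distributed on $\Delta^{n,u}$, written $\Theta\sim\mathcal{U}(\Delta^{n,u})$, if $\mathbb{P}(\Theta\in C)=\mathrm{Vol}(C)/\mathrm{Vol}(\Delta^{n,u})$ for every measurable $C\subseteq\Delta^{n,u}$, where $\mathrm{Vol}$ is the $(n-1)$-dimensional volume. The random variable $\max(\Theta)$ is $\max_{1\le i\le n}\Theta_i$. *)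

theory Defs
  imports "HOL-Probability.Probability"
begin

text \<open>
  The \<open>d\<close>-dimensional volume of a subset of a Euclidean space of larger dimension is taken to be
  the \<open>d\<close>-dimensional Hausdorff measure. The factor \<open>unit_ball_vol d / 2 ^ d\<close> is the usual
  normalization making it agree with Lebesgue measure on \<open>d\<close>-dimensional affine subspaces.
  The covering sets are required to be bounded because \<open>diameter\<close> is meaningful only for
  bounded sets; empty sets in a cover contribute \<open>0\<close>, which matters only for \<open>d = 0\<close>.
\<close>

definition hausdorff_content :: "nat \<Rightarrow> real \<Rightarrow> 'a::metric_space set \<Rightarrow> ennreal" where
  "hausdorff_content d \<delta> A =
     (INF U \<in> {U :: nat \<Rightarrow> 'a set. A \<subseteq> (\<Union>i. U i) \<and> (\<forall>i. bounded (U i) \<and> diameter (U i) \<le> \<delta>)}.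
        \<Sum>i. if U i = {} then 0
            else ennreal (unit_ball_vol (real d) * (diameter (U i) / 2) ^ d))"

definition hausdorff_measure :: "nat \<Rightarrow> 'a::metric_space set \<Rightarrow> ennreal" where
  "hausdorff_measure d A = (SUP \<delta> \<in> {0<..}. hausdorff_content d \<delta> A)"

definition simplex_of_size :: "real \<Rightarrow> (real ^ 'n::finite) set" where
  "simplex_of_size u = {\<theta>. (\<Sum>i\<in>UNIV. \<theta> $ i) = u \<and> (\<forall>i. 0 \<le> \<theta> $ i)}"

definition uniform_on_simplex :: "'w measure \<Rightarrow> real \<Rightarrow> ('w \<Rightarrow> real ^ 'n::finite) \<Rightarrow> bool" where
  "uniform_on_simplex M u \<Theta> \<longleftrightarrow>
     \<Theta> \<in> borel_measurable M \<and>
     (\<forall>C \<in> sets borel. C \<subseteq> simplex_of_size u \<longrightarrow>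
        emeasure M {\<omega> \<in> space M. \<Theta> \<omega> \<in> C} =
          hausdorff_measure (CARD('n) - 1) C /
          hausdorff_measure (CARD('n) - 1) (simplex_of_size u :: (real ^ 'n) set))"

end

theory Submission
  imports Defs
begin

text \<open>
  Let \<open>d = n - 1\<close>. The law of \<open>\<Theta>\<close> gives a Borel subset of the simplex a probability proportional to
  its \<open>d\<close>-dimensional Hausdorff measure, so only ratios of Hausdorff measures matter. They are found
  without comparing Hausdorff and Lebesgue measure exactly: a homothety of ratio \<open>c\<close> multiplies the
  Hausdorff measure by \<open>c ^ d\<close> (\<open>hausdorff_measure_homothety\<close>), and the measure of the simplex is
  finite and positive (\<open>hausdorff_measure_simplex_finite\<close>, \<open>hausdorff_measure_simplex_pos\<close>), for
  which crude coverings suffice. The additivity that inclusion-exclusion relies on is that of the law of \<open>\<Theta>\<close>.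

  For a set \<open>I\<close> of \<open>k\<close> coordinates, the part of the simplex on which all coordinates in \<open>I\<close> are at
  least \<open>b\<close> is a translate of the simplex of size \<open>u - k * b\<close> and hence has probability
  \<open>(1 - k * b / u) ^ d\<close>, or \<open>0\<close> if \<open>k * b \<ge> u\<close> (\<open>uniform_on_simplex_corner\<close>). As this is continuous
  in \<open>b\<close>, ties \<open>\<theta> $ i = b\<close> have probability \<open>0\<close>, and inclusion-exclusion expresses the probability of
  \<open>max \<le> b\<close> as the sum of \<open>(-1) ^ k * (n choose k) * (1 - k * b / u) ^ d\<close> over the \<open>k\<close> with
  \<open>k * b < u\<close> (\<open>uniform_on_simplex_all_le\<close>).

  The claimed formula is the complementary half of the same alternating sum: the sum over all
  \<open>k \<le> n\<close> is the \<open>n\<close>-th finite difference of a polynomial of degree \<open>d < n\<close> and vanishes. Replacing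
  \<open>k\<close> by \<open>n - k\<close> in the other half gives the terms \<open>((n - k) * b - u) ^ d\<close>
  (\<open>alternating_truncated_power_sum_reflect\<close>); those with a positive base are exactly the ones with
  \<open>k \<le> m\<close>.
\<close>

section \<open>Hausdorff measure under Lipschitz maps and homotheties\<close>

lemma diameter_Lipschitz_image_le:
  fixes f :: "'a::metric_space \<Rightarrow> 'b::metric_space"
  assumes "bounded U" and "\<And>x y. dist (f x) (f y) \<le> c * dist x y" and "0 \<le> c"
  shows "bounded (f ` U)" and "diameter (f ` U) \<le> c * diameter U"
proof -
  have le: "dist (f x) (f y) \<le> c * diameter U" if "x \<in> U" "y \<in> U" for x y
    using assms(2)[of x y] mult_left_mono[OF diameter_bounded_bound[OF \<open>bounded U\<close> that] \<open>0 \<le> c\<close>]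
    by linarith
  show "bounded (f ` U)"
    unfolding bounded_two_points using le by blast
  show "diameter (f ` U) \<le> c * diameter U"
  proof (cases "U = {}")
    case False
    then show ?thesis
      by (auto simp: diameter_def[of "f ` U"] intro!: cSUP_least le)
  qed auto
qed

text \<open>
  A cover of \<open>A\<close> at scale \<open>\<delta> / c\<close> is mapped to a cover of \<open>f ` A\<close> at scale \<open>\<delta>\<close>, and every
  term of the covering sum grows at most by the factor \<open>c ^ d\<close>.
\<close>
lemma hausdorff_measure_Lipschitz_image_le:
  fixes f :: "'a::metric_space \<Rightarrow> 'b::metric_space"
  assumes lip: "\<And>x y. dist (f x) (f y) \<le> c * dist x y" and "0 < c"
  shows "hausdorff_measure d (f ` A) \<le> ennreal (c ^ d) * hausdorff_measure d A"
proof -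
  have "hausdorff_content d \<delta> (f ` A) \<le> ennreal (c ^ d) * hausdorff_measure d A"
    if "0 < \<delta>" for \<delta>
  proof -
    define weight where "weight (U :: 'a set) =
        (if U = {} then 0 else ennreal (unit_ball_vol (real d) * (diameter U / 2) ^ d))" for U
    have "ennreal (1 / c ^ d) * hausdorff_content d \<delta> (f ` A) \<le> hausdorff_content d (\<delta> / c) A"
      unfolding hausdorff_content_def[of d "\<delta> / c" A]
    proof (rule INF_greatest)
      fix U :: "nat \<Rightarrow> 'a set"
      assume "U \<in> {U. A \<subseteq> (\<Union>i. U i) \<and> (\<forall>i. bounded (U i) \<and> diameter (U i) \<le> \<delta> / c)}"
      then have U: "A \<subseteq> (\<Union>i. U i)" "\<And>i. bounded (U i)" "\<And>i. diameter (U i) \<le> \<delta> / c"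
        by auto
      have diam: "diameter (f ` U i) \<le> c * diameter (U i)" for i
        using diameter_Lipschitz_image_le(2)[OF U(2) lip] \<open>0 < c\<close> by simp
      have "c * diameter (U i) \<le> \<delta>" for i
        using U(3)[of i] \<open>0 < c\<close> by (simp add: field_simps)
      then have "diameter (f ` U i) \<le> \<delta>" for i
        using diam[of i] by (meson order_trans)
      moreover have "bounded (f ` U i)" for i
        using diameter_Lipschitz_image_le(1)[OF U(2) lip] \<open>0 < c\<close> by simp
      moreover have "f ` A \<subseteq> (\<Union>i. f ` U i)"
        using U(1) by blast
      ultimately have "hausdorff_content d \<delta> (f ` A) \<le> (\<Sum>i. if f ` U i = {} then 0
            else ennreal (unit_ball_vol (real d) * (diameter (f ` U i) / 2) ^ d))"
        unfolding hausdorff_content_def by (intro INF_lower) simp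
      also have "\<dots> \<le> (\<Sum>i. ennreal (c ^ d) * weight (U i))"
      proof (intro suminf_le)
        show "(if f ` U i = {} then 0
              else ennreal (unit_ball_vol (real d) * (diameter (f ` U i) / 2) ^ d))
            \<le> ennreal (c ^ d) * weight (U i)" for i
        proof (cases "U i = {}")
          case False
          have "(diameter (f ` U i) / 2) ^ d \<le> (c * (diameter (U i) / 2)) ^ d"
            using diam[of i] diameter_ge_0[OF diameter_Lipschitz_image_le(1)[OF U(2) lip]] \<open>0 < c\<close>
            by (intro power_mono) auto
          then have "(diameter (f ` U i) / 2) ^ d \<le> c ^ d * (diameter (U i) / 2) ^ d"
            by (simp only: power_mult_distrib)
          then have "unit_ball_vol (real d) * (diameter (f ` U i) / 2) ^ d
              \<le> c ^ d * (unit_ball_vol (real d) * (diameter (U i) / 2) ^ d)"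
            using mult_left_mono[of _ _ "unit_ball_vol (real d)"]
            by (simp add: mult.left_commute)
          then show ?thesis
            using False \<open>0 < c\<close> by (simp add: weight_def ennreal_mult'[symmetric] ennreal_leI)
        qed (simp add: weight_def)
      qed auto
      also have "\<dots> = ennreal (c ^ d) * (\<Sum>i. weight (U i))"
        by (rule ennreal_suminf_cmult)
      finally have "ennreal (1 / c ^ d) * hausdorff_content d \<delta> (f ` A)
          \<le> ennreal (1 / c ^ d) * (ennreal (c ^ d) * (\<Sum>i. weight (U i)))"
        by (rule mult_left_mono) simp
      also have "\<dots> = (\<Sum>i. weight (U i))"
        using \<open>0 < c\<close> by (simp add: mult.assoc[symmetric] ennreal_mult'[symmetric])
      finally show "ennreal (1 / c ^ d) * hausdorff_content d \<delta> (f ` A) \<le> (\<Sum>i. if U i = {} then 0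
          else ennreal (unit_ball_vol (real d) * (diameter (U i) / 2) ^ d))"
        by (simp add: weight_def)
    qed
    also have "\<dots> \<le> hausdorff_measure d A"
      unfolding hausdorff_measure_def using \<open>0 < \<delta>\<close> \<open>0 < c\<close> by (intro SUP_upper) simp
    finally have "ennreal (c ^ d) * (ennreal (1 / c ^ d) * hausdorff_content d \<delta> (f ` A))
        \<le> ennreal (c ^ d) * hausdorff_measure d A"
      by (rule mult_left_mono) simp
    then show ?thesis
      using \<open>0 < c\<close> by (simp add: mult.assoc[symmetric] ennreal_mult'[symmetric])
  qed
  then show ?thesis
    unfolding hausdorff_measure_def[of d "f ` A"] by (intro SUP_least) auto
qed

text \<open>
  A homothety and its inverse are Lipschitz with constants \<open>c\<close> and \<open>1 / c\<close>, so the two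
  Lipschitz bounds combine to an equality.
\<close>
lemma hausdorff_measure_homothety:
  fixes A :: "'a::real_normed_vector set"
  assumes "0 < c"
  shows "hausdorff_measure d ((\<lambda>x. c *\<^sub>R x + v) ` A) = ennreal (c ^ d) * hausdorff_measure d A"
proof (rule antisym)
  have "dist (c *\<^sub>R x + v) (c *\<^sub>R y + v) \<le> c * dist x y" for x y
    using \<open>0 < c\<close> by (simp add: dist_norm flip: scaleR_diff_right)
  then show "hausdorff_measure d ((\<lambda>x. c *\<^sub>R x + v) ` A) \<le> ennreal (c ^ d) * hausdorff_measure d A"
    using \<open>0 < c\<close> by (rule hausdorff_measure_Lipschitz_image_le)
  define g where "g y = (1 / c) *\<^sub>R (y - v)" for y
  have "dist (g x) (g y) \<le> (1 / c) * dist x y" for x y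
    using \<open>0 < c\<close> by (simp add: g_def dist_norm flip: scaleR_diff_right)
  then have "hausdorff_measure d (g ` (\<lambda>x. c *\<^sub>R x + v) ` A)
      \<le> ennreal ((1 / c) ^ d) * hausdorff_measure d ((\<lambda>x. c *\<^sub>R x + v) ` A)"
    using \<open>0 < c\<close> by (intro hausdorff_measure_Lipschitz_image_le) auto
  moreover have "g ` (\<lambda>x. c *\<^sub>R x + v) ` A = A"
    using \<open>0 < c\<close> by (simp add: g_def image_image)
  ultimately have "ennreal (c ^ d) * hausdorff_measure d A
      \<le> ennreal (c ^ d) * (ennreal ((1 / c) ^ d) * hausdorff_measure d ((\<lambda>x. c *\<^sub>R x + v) ` A))"
    by (metis mult_left_mono zero_le)
  then show "ennreal (c ^ d) * hausdorff_measure d A \<le> hausdorff_measure d ((\<lambda>x. c *\<^sub>R x + v) ` A)"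
    using \<open>0 < c\<close> by (simp add: mult.assoc[symmetric] ennreal_mult'[symmetric] power_one_over)
qed

lemma hausdorff_content_le_finite_cover:
  fixes A :: "'a::metric_space set"
  assumes "finite F" and "A \<subseteq> (\<Union>i\<in>F. V i)" and "\<And>i. i \<in> F \<Longrightarrow> bounded (V i)"
    and "\<And>i. i \<in> F \<Longrightarrow> diameter (V i) \<le> \<epsilon>" and "0 \<le> \<epsilon>" and "\<epsilon> \<le> \<delta>"
  shows "hausdorff_content d \<delta> A
    \<le> ennreal (real (card F) * (unit_ball_vol (real d) * (\<epsilon> / 2) ^ d))"
proof -
  obtain e where e: "bij_betw e {0..<card F} F"
    using ex_bij_betw_nat_finite[OF \<open>finite F\<close>] by blast
  define U where "U i = (if i < card F then V (e i) else {})" for i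
  have eF: "e i \<in> F" if "i < card F" for i
    using e that by (auto simp: bij_betw_def)
  have "A \<subseteq> (\<Union>i. U i)"
  proof
    fix x assume "x \<in> A"
    then obtain j where "j \<in> F" "x \<in> V j"
      using assms(2) by blast
    moreover obtain i where "i < card F" "e i = j"
      using e \<open>j \<in> F\<close> unfolding bij_betw_def by (metis atLeastLessThan_iff imageE)
    ultimately show "x \<in> (\<Union>i. U i)"
      by (auto simp: U_def intro!: exI[of _ i])
  qed
  moreover have "bounded (U i)" "diameter (U i) \<le> \<epsilon>" for i
    using assms eF by (auto simp: U_def)
  moreover have "diameter (U i) \<le> \<delta>" for i
    using \<open>\<And>i. diameter (U i) \<le> \<epsilon>\<close> \<open>\<epsilon> \<le> \<delta>\<close> by (rule order_trans)
  ultimately have "hausdorff_content d \<delta> A \<le> (\<Sum>i. if U i = {} then 0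
      else ennreal (unit_ball_vol (real d) * (diameter (U i) / 2) ^ d))"
    unfolding hausdorff_content_def by (intro INF_lower) simp
  also have "\<dots> = (\<Sum>i<card F. if U i = {} then 0
      else ennreal (unit_ball_vol (real d) * (diameter (U i) / 2) ^ d))"
    by (rule suminf_finite) (auto simp: U_def)
  also have "\<dots> \<le> (\<Sum>i<card F. ennreal (unit_ball_vol (real d) * (\<epsilon> / 2) ^ d))"
    using \<open>\<And>i. bounded (U i)\<close> \<open>\<And>i. diameter (U i) \<le> \<epsilon>\<close> \<open>0 \<le> \<epsilon>\<close>
    by (intro sum_mono) (auto intro!: ennreal_leI mult_left_mono power_mono divide_right_mono diameter_ge_0)
  also have "\<dots> = ennreal (real (card F) * (unit_ball_vol (real d) * (\<epsilon> / 2) ^ d))"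
    using \<open>0 \<le> \<epsilon>\<close> by (simp add: ennreal_mult' ennreal_of_nat_eq_real_of_nat)
  finally show ?thesis .
qed

lemma hausdorff_measure_mono:
  assumes "A \<subseteq> B"
  shows "hausdorff_measure d A \<le> hausdorff_measure d B"
proof -
  have "hausdorff_content d \<delta> A \<le> hausdorff_content d \<delta> B" for \<delta>
    unfolding hausdorff_content_def using assms by (intro INF_superset_mono) auto
  then show ?thesis
    unfolding hausdorff_measure_def by (intro SUP_mono) auto
qed

lemma hausdorff_measure_singleton:
  fixes p :: "'a::metric_space"
  assumes "0 < d"
  shows "hausdorff_measure d {p} = 0"
proof -
  have "hausdorff_content d \<delta> {p} \<le> 0" if "0 < \<delta>" for \<delta>
    using hausdorff_content_le_finite_cover[of "{()}" "{p}" "\<lambda>_. {p}" 0 \<delta> d] that assms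
    by (simp add: zero_power)
  then have "hausdorff_measure d {p} \<le> 0"
    unfolding hausdorff_measure_def by (intro SUP_least) auto
  then show ?thesis by simp
qed

section \<open>The simplex has finite and positive measure\<close>

text \<open>
  On the simplex one coordinate \<open>i0\<close> is determined by the others. Dividing the ranges of the
  \<open>d = CARD('n) - 1\<close> free coordinates into intervals of length \<open>h = u / N\<close> therefore cuts the
  simplex into at most \<open>(N + 1) ^ d\<close> cells of diameter at most \<open>2 * d * h\<close>, and the resulting
  covering sum stays bounded as \<open>N\<close> grows.
\<close>
lemma hausdorff_measure_simplex_finite:
  assumes "0 < u"
  shows "hausdorff_measure (CARD('n) - 1) (simplex_of_size u :: (real ^ 'n::finite) set) < \<infinity>"
proof -
  define d where "d = CARD('n) - 1"
  obtain i0 :: 'n where True by simp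
  define K where "K = unit_ball_vol (real d) * (2 * real d * u) ^ d"
  have cardI: "card (UNIV - {i0}) = d"
    by (simp add: d_def card_Diff_singleton)
  have "hausdorff_content d \<delta> (simplex_of_size u :: (real ^ 'n) set) \<le> ennreal K" if "0 < \<delta>" for \<delta>
  proof -
    \<comment> \<open>Large enough for the cells to have diameter at most \<open>\<delta>\<close>.\<close>
    obtain N where N: "2 * real d * u / \<delta> < real N"
      using reals_Archimedean2 by blast
    have "0 \<le> 2 * real d * u / \<delta>" using \<open>0 < u\<close> \<open>0 < \<delta>\<close> by simp
    then have "0 < N" using N by (metis of_nat_0_less_iff order_le_less_trans)
    define h where "h = u / real N"
    have "0 < h" using \<open>0 < u\<close> \<open>0 < N\<close> by (simp add: h_def)
    have small: "2 * real d * h \<le> \<delta>"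
      using N \<open>0 < \<delta>\<close> \<open>0 < N\<close> by (simp add: h_def field_simps)
    \<comment> \<open>The top index \<open>N\<close> is reached only by a coordinate equal to \<open>u\<close>.\<close>
    define F where "F = (UNIV - {i0}) \<rightarrow>\<^sub>E {..N}"
    define V where "V f = {\<theta> \<in> simplex_of_size u. \<forall>i\<in>UNIV - {i0}.
        real (f i) * h \<le> \<theta> $ i \<and> \<theta> $ i \<le> (real (f i) + 1) * h}" for f :: "'n \<Rightarrow> nat"
    have "finite F" and card: "card F = Suc N ^ d"
      by (simp_all add: F_def finite_PiE card_PiE cardI)
    have cover: "(simplex_of_size u :: (real ^ 'n) set) \<subseteq> (\<Union>f\<in>F. V f)"
    proof
      fix \<theta> :: "real ^ 'n" assume \<theta>: "\<theta> \<in> simplex_of_size u"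
      define f where "f = (\<lambda>i\<in>UNIV - {i0}. nat \<lfloor>\<theta> $ i / h\<rfloor>)"
      have nonneg: "0 \<le> \<theta> $ i" for i
        using \<theta> by (simp add: simplex_of_size_def)
      have "\<theta> $ i \<le> u" for i
        using \<theta> member_le_sum[of i UNIV "\<lambda>i. \<theta> $ i"] by (simp add: simplex_of_size_def)
      then have "\<theta> $ i / h \<le> real N" for i
        using \<open>0 < u\<close> \<open>0 < N\<close> by (simp add: h_def field_simps)
      then have "nat \<lfloor>\<theta> $ i / h\<rfloor> \<le> N" for i
        by (metis floor_mono floor_of_nat nat_le_iff)
      then have "f \<in> F" by (auto simp: f_def F_def)
      moreover have "\<theta> \<in> V f"
      proof -
        have "real (nat \<lfloor>\<theta> $ i / h\<rfloor>) \<le> \<theta> $ i / h \<and> \<theta> $ i / h \<le> real (nat \<lfloor>\<theta> $ i / h\<rfloor>) + 1" for i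
          using nonneg[of i] \<open>0 < h\<close> by simp
        then show ?thesis
          using \<theta> \<open>0 < h\<close> by (simp add: V_def f_def pos_le_divide_eq pos_divide_le_eq)
      qed
      ultimately show "\<theta> \<in> (\<Union>f\<in>F. V f)" by blast
    qed
    have dist_le: "dist x y \<le> 2 * real d * h" if "x \<in> V f" "y \<in> V f" for f x y
    proof -
      have sums: "(\<Sum>i\<in>UNIV. x $ i) = u" "(\<Sum>i\<in>UNIV. y $ i) = u"
        using that by (auto simp: V_def simplex_of_size_def)
      have le: "\<bar>x $ i - y $ i\<bar> \<le> h" if "i \<noteq> i0" for i
      proof -
        have "real (f i) * h \<le> x $ i" "x $ i \<le> (real (f i) + 1) * h"
          "real (f i) * h \<le> y $ i" "y $ i \<le> (real (f i) + 1) * h"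
          using \<open>x \<in> V f\<close> \<open>y \<in> V f\<close> that by (auto simp: V_def)
        then show ?thesis by (simp add: distrib_right abs_le_iff)
      qed
      have rest: "(\<Sum>i\<in>UNIV - {i0}. \<bar>x $ i - y $ i\<bar>) \<le> real d * h"
        using sum_bounded_above[of "UNIV - {i0}" "\<lambda>i. \<bar>x $ i - y $ i\<bar>" h] le by (simp add: cardI)
      have "x $ i0 - y $ i0 = - (\<Sum>i\<in>UNIV - {i0}. x $ i - y $ i)"
        using sums by (simp add: sum.remove[of UNIV i0] sum_subtractf)
      then have "\<bar>x $ i0 - y $ i0\<bar> \<le> real d * h"
        using order_trans[OF sum_abs rest] by simp
      then have "(\<Sum>i\<in>UNIV. \<bar>x $ i - y $ i\<bar>) \<le> 2 * real d * h"
        using rest by (simp add: sum.remove[of UNIV i0])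
      then show ?thesis
        using norm_le_l1_cart[of "x - y"] by (simp add: dist_norm)
    qed
    have "hausdorff_content d \<delta> (simplex_of_size u :: (real ^ 'n) set)
        \<le> ennreal (real (card F) * (unit_ball_vol (real d) * (2 * real d * h / 2) ^ d))"
    proof (rule hausdorff_content_le_finite_cover[OF \<open>finite F\<close> cover])
      show "bounded (V f)" for f
        unfolding bounded_two_points using dist_le by blast
      show "diameter (V f) \<le> 2 * real d * h" for f
        using dist_le[of _ f] \<open>0 < h\<close> by (intro diameter_le) (auto simp: dist_norm)
    qed (use \<open>0 < h\<close> small in auto)
    also have "\<dots> = ennreal (unit_ball_vol (real d) * (real (Suc N) * (real d * h)) ^ d)"
      by (simp add: card power_mult_distrib mult_ac del: of_nat_Suc)
    also have "\<dots> \<le> ennreal K"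
    proof -
      have "real (Suc N) * h \<le> 2 * u"
        using \<open>0 < u\<close> \<open>0 < N\<close> by (simp add: h_def field_simps)
      then have "real d * (real (Suc N) * h) \<le> real d * (2 * u)"
        by (rule mult_left_mono) simp
      then show ?thesis
        using \<open>0 < h\<close> unfolding K_def
        by (intro ennreal_leI mult_left_mono power_mono) (auto simp: mult_ac)
    qed
    finally show ?thesis .
  qed
  then have "hausdorff_measure d (simplex_of_size u :: (real ^ 'n) set) \<le> ennreal K"
    unfolding hausdorff_measure_def by (intro SUP_least) auto
  then show ?thesis
    unfolding d_def using ennreal_less_top le_less_trans infinity_ennreal_def by metis
qed
lemma emeasure_lborel_cbox_cart:
  fixes a b :: "real ^ 'n::finite"
  assumes "\<And>i. a $ i \<le> b $ i"
  shows "emeasure lborel (cbox a b) = ennreal (\<Prod>i\<in>UNIV. b $ i - a $ i)"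
proof -
  have "cbox a b \<noteq> {}"
    using assms by (auto simp: interval_ne_empty_cart)
  then show ?thesis
    using content_cbox_cart[of a b] emeasure_eq_ennreal_measure[of lborel "cbox a b"]
    by (simp add: emeasure_lborel_cbox_eq)
qed

text \<open>
  Forgetting the coordinate \<open>i0\<close> projects the simplex onto a set that contains a cube of side
  \<open>h = u / CARD('n)\<close>. A covering set of diameter \<open>D\<close> projects into some cube of side \<open>2 * D\<close>, so
  the countable subadditivity of Lebesgue measure bounds every covering sum from below by a
  multiple of \<open>h ^ d\<close>. To stay within the type
  of full-dimensional vectors, all these \<open>d\<close>-dimensional cubes are multiplied by the unit interval
  in direction \<open>i0\<close>, which does not change their volumes.
\<close>
lemma hausdorff_measure_simplex_pos:
  assumes "0 < u"
  shows "0 < hausdorff_measure (CARD('n) - 1) (simplex_of_size u :: (real ^ 'n::finite) set)"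
proof -
  define d where "d = CARD('n) - 1"
  obtain i0 :: 'n where True by simp
  have cardI: "card (UNIV - {i0}) = d"
    by (simp add: d_def card_Diff_singleton)
  define h where "h = u / real CARD('n)"
  have "0 < h" using \<open>0 < u\<close> by (simp add: h_def)
  have prod_slab: "(\<Prod>i\<in>UNIV. if i = i0 then 1 else r) = r ^ d" for r :: real
    using cardI by (simp add: prod.remove[of UNIV i0])
  define T where "T = cbox (0 :: real ^ 'n) (\<chi> i. if i = i0 then 1 else h)"
  have T: "emeasure lborel T = ennreal (h ^ d)"
    using \<open>0 < h\<close> by (simp add: T_def emeasure_lborel_cbox_cart prod_slab)
  \<comment> \<open>The factor between \<open>(2 * D) ^ d\<close> and the weight \<open>unit_ball_vol d * (D / 2) ^ d\<close>.\<close>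
  define c where "c = unit_ball_vol (real d) / 4 ^ d"
  have "0 < c" by (simp add: c_def)
  have "ennreal (c * h ^ d) \<le> hausdorff_content d 1 (simplex_of_size u :: (real ^ 'n) set)"
    unfolding hausdorff_content_def
  proof (rule INF_greatest)
    fix U :: "nat \<Rightarrow> (real ^ 'n) set"
    assume "U \<in> {U. simplex_of_size u \<subseteq> (\<Union>i. U i) \<and> (\<forall>i. bounded (U i) \<and> diameter (U i) \<le> 1)}"
    then have cover: "simplex_of_size u \<subseteq> (\<Union>i. U i)" and bdd: "\<And>i. bounded (U i)"
      by auto
    define D where "D k = diameter (U k)" for k
    have "0 \<le> D k" for k using bdd by (simp add: D_def diameter_ge_0)
    define p where "p k = (SOME x. x \<in> U k)" for k
    have p: "p k \<in> U k" if "x \<in> U k" for k x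
      unfolding p_def using that by (rule someI)
    define V where "V k = (if U k = {} then {} else
        cbox (\<chi> i. if i = i0 then 0 else p k $ i - D k) (\<chi> i. if i = i0 then 1 else p k $ i + D k))" for k
    have V: "emeasure lborel (V k) = (if U k = {} then 0 else ennreal ((2 * D k) ^ d))" for k
    proof -
      have "(\<Prod>i\<in>UNIV. (if i = i0 then 1 else p k $ i + D k) - (if i = i0 then 0 else p k $ i - D k))
          = (\<Prod>i\<in>UNIV. if i = i0 then 1 else 2 * D k)"
        by (rule prod.cong) auto
      then show ?thesis
        using \<open>0 \<le> D k\<close> by (simp add: V_def emeasure_lborel_cbox_cart prod_slab)
    qed
    have "T \<subseteq> (\<Union>k. V k)"
    proof
      fix x assume "x \<in> T"
      then have x: "0 \<le> x $ i" "x $ i \<le> (if i = i0 then 1 else h)" for i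
        by (auto simp: T_def mem_box_cart)
      define s where "s = (\<Sum>i\<in>UNIV - {i0}. x $ i)"
      \<comment> \<open>The point of the simplex with the same projection as \<open>x\<close>.\<close>
      define y where "y = (\<chi> i. if i = i0 then u - s else x $ i)"
      have "x $ i \<le> h" if "i \<noteq> i0" for i
        using x(2)[of i] that by simp
      then have "s \<le> real d * h"
        using sum_bounded_above[of "UNIV - {i0}" "\<lambda>i. x $ i" h] by (simp add: cardI s_def)
      also have "\<dots> \<le> u"
        using \<open>0 < u\<close> by (simp add: h_def d_def field_simps)
      finally have "s \<le> u" .
      have "(\<Sum>i\<in>UNIV. y $ i) = u"
        by (simp add: y_def sum.remove[of UNIV i0] s_def)
      then have "y \<in> simplex_of_size u"
        using x(1) \<open>s \<le> u\<close> by (simp add: simplex_of_size_def y_def)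
      then obtain k where k: "y \<in> U k" using cover by blast
      have "\<bar>y $ i - p k $ i\<bar> \<le> D k" for i
        using component_le_norm_cart[of "y - p k" i] diameter_bounded_bound[OF bdd k p[OF k]]
        by (simp add: dist_norm D_def)
      moreover have "y $ i = x $ i" if "i \<noteq> i0" for i
        using that by (simp add: y_def)
      ultimately have near: "\<bar>x $ i - p k $ i\<bar> \<le> D k" if "i \<noteq> i0" for i
        using that by metis
      have "p k $ i - D k \<le> x $ i" "x $ i \<le> p k $ i + D k" if "i \<noteq> i0" for i
        using near[OF that] by linarith+
      moreover have "0 \<le> x $ i0" "x $ i0 \<le> 1"
        using x[of i0] by simp_all
      moreover have "U k \<noteq> {}"
        using k by blast
      ultimately have "x \<in> V k"
        by (simp add: V_def mem_box_cart)
      then show "x \<in> (\<Union>k. V k)" by blast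
    qed
    then have "emeasure lborel T \<le> emeasure lborel (\<Union>k. V k)"
      by (rule emeasure_mono) (auto simp: V_def)
    also have "\<dots> \<le> (\<Sum>k. emeasure lborel (V k))"
      by (rule emeasure_subadditive_countably) (auto simp: V_def)
    finally have "ennreal c * ennreal (h ^ d) \<le> ennreal c * (\<Sum>k. emeasure lborel (V k))"
      unfolding T by (rule mult_left_mono) simp
    also have "\<dots> = (\<Sum>k. ennreal c * emeasure lborel (V k))"
      by (rule ennreal_suminf_cmult[symmetric])
    also have "\<dots> = (\<Sum>k. if U k = {} then 0
            else ennreal (unit_ball_vol (real d) * (diameter (U k) / 2) ^ d))"
    proof (rule suminf_cong)
      fix k
      have "c * (2 * D k) ^ d = unit_ball_vol (real d) * (diameter (U k) / 2) ^ d"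
      proof -
        have "(2 * D k) ^ d = 4 ^ d * (D k / 2) ^ d"
          using power_mult_distrib[of 4 "D k / 2" d] by simp
        then show ?thesis by (simp add: c_def D_def)
      qed
      then show "ennreal c * emeasure lborel (V k) = (if U k = {} then 0
            else ennreal (unit_ball_vol (real d) * (diameter (U k) / 2) ^ d))"
        using \<open>0 < c\<close> by (simp add: V ennreal_mult'[symmetric])
    qed
    finally show "ennreal (c * h ^ d) \<le> (\<Sum>k. if U k = {} then 0
            else ennreal (unit_ball_vol (real d) * (diameter (U k) / 2) ^ d))"
      using \<open>0 < c\<close> by (simp add: ennreal_mult')
  qed
  also have "\<dots> \<le> hausdorff_measure d (simplex_of_size u :: (real ^ 'n) set)"
    unfolding hausdorff_measure_def by (intro SUP_upper) simp
  finally have "ennreal (c * h ^ d) \<le> hausdorff_measure d (simplex_of_size u :: (real ^ 'n) set)" .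
  moreover have "0 < ennreal (c * h ^ d)"
    using \<open>0 < c\<close> \<open>0 < h\<close> by (simp add: ennreal_less_zero_iff)
  ultimately show ?thesis
    unfolding d_def by (rule less_le_trans[rotated])
qed

section \<open>Corners of the simplex\<close>

lemma closed_simplex_of_size: "closed (simplex_of_size u :: (real ^ 'n::finite) set)"
  unfolding simplex_of_size_def
  by (intro closed_Collect_conj closed_Collect_eq closed_Collect_all closed_Collect_le continuous_intros)

text \<open>
  Subtracting \<open>t\<close> from the coordinates in \<open>I\<close> turns the corner into the simplex of size
  \<open>u - card I * t\<close>, a scaled copy of the simplex of size \<open>u\<close>.
\<close>
lemma simplex_corner_homothetic:
  fixes I :: "'n::finite set"
  assumes "0 < u" and "0 \<le> t" and "real (card I) * t < u"
  defines "c \<equiv> 1 - real (card I) * t / u"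
  shows "{\<theta> \<in> simplex_of_size u. \<forall>i\<in>I. t \<le> \<theta> $ i}
    = (\<lambda>x. c *\<^sub>R x + (\<chi> i. if i \<in> I then t else 0)) ` (simplex_of_size u :: (real ^ 'n) set)"
    (is "?C = ?f ` _")
proof
  have "0 < c" and cu: "c * u = u - real (card I) * t"
    using assms by (auto simp: field_simps)
  have sum_t: "(\<Sum>i\<in>UNIV. if i \<in> I then t else 0) = real (card I) * t"
    by (simp add: sum.If_cases)
  show "?f ` simplex_of_size u \<subseteq> ?C"
    using \<open>0 < c\<close> \<open>0 \<le> t\<close> cu
    by (auto simp: simplex_of_size_def sum.distrib sum_t simp flip: sum_distrib_left)
  show "?C \<subseteq> ?f ` simplex_of_size u"
  proof
    fix \<theta> :: "real ^ 'n" assume \<theta>: "\<theta> \<in> ?C"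
    define x where "x = (1 / c) *\<^sub>R (\<theta> - (\<chi> i. if i \<in> I then t else 0))"
    have "(\<Sum>i\<in>UNIV. x $ i) = (1 / c) * (u - real (card I) * t)"
      using \<theta> by (simp add: x_def simplex_of_size_def sum_subtractf sum_t flip: sum_divide_distrib)
    also have "\<dots> = u"
      using \<open>0 < c\<close> by (simp flip: cu)
    finally have "x \<in> simplex_of_size u"
      using \<theta> \<open>0 < c\<close> by (auto simp: simplex_of_size_def x_def)
    moreover have "\<theta> = ?f x"
      using \<open>0 < c\<close> by (simp add: x_def)
    ultimately show "\<theta> \<in> ?f ` simplex_of_size u" by blast
  qed
qed

text \<open>
  When \<open>card I * t\<close> reaches \<open>u\<close>, the corner shrinks to at most one point, which is null in positive
  dimension; this is why the truncation at \<open>0\<close> gives the right value.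
\<close>
lemma hausdorff_measure_simplex_corner:
  fixes I :: "'n::finite set"
  assumes "0 < u" and "0 \<le> t" and "2 \<le> CARD('n)"
  shows "hausdorff_measure (CARD('n) - 1) {\<theta> \<in> simplex_of_size u. \<forall>i\<in>I. t \<le> \<theta> $ i}
    = ennreal (max 0 (1 - real (card I) * t / u) ^ (CARD('n) - 1))
      * hausdorff_measure (CARD('n) - 1) (simplex_of_size u :: (real ^ 'n) set)"
proof (cases "real (card I) * t < u")
  case True
  then have "0 < 1 - real (card I) * t / u"
    using \<open>0 < u\<close> by simp
  then show ?thesis
    unfolding simplex_corner_homothetic[OF assms(1,2) True]
    by (simp add: hausdorff_measure_homothety)
next
  case False
  have "0 < CARD('n) - 1" using assms(3) by simp
  have "\<theta> = (\<chi> i. if i \<in> I then t else 0)"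
    if "\<theta> \<in> simplex_of_size u" "\<forall>i\<in>I. t \<le> \<theta> $ i" for \<theta> :: "real ^ 'n"
  proof -
    define y where "y i = \<theta> $ i - (if i \<in> I then t else 0)" for i
    have y: "0 \<le> y i" for i
      using that by (auto simp: y_def simplex_of_size_def)
    moreover have "(\<Sum>i\<in>UNIV. y i) = u - real (card I) * t"
      using that by (simp add: y_def simplex_of_size_def sum_subtractf sum.If_cases)
    ultimately have "(\<Sum>i\<in>UNIV. y i) = 0"
      using False sum_nonneg[of UNIV y] by simp
    then have "y i = 0" for i
      using y by (simp add: sum_nonneg_eq_0_iff)
    then show ?thesis
      by (simp add: vec_eq_iff y_def)
  qed
  then have "{\<theta> \<in> simplex_of_size u. \<forall>i\<in>I. t \<le> \<theta> $ i} \<subseteq> {\<chi> i. if i \<in> I then t else 0}"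
    by blast
  then have "hausdorff_measure (CARD('n) - 1) {\<theta> \<in> simplex_of_size u. \<forall>i\<in>I. t \<le> \<theta> $ i}
      \<le> hausdorff_measure (CARD('n) - 1) {(\<chi> i. if i \<in> I then t else 0) :: real ^ 'n}"
    by (rule hausdorff_measure_mono)
  then have "hausdorff_measure (CARD('n) - 1) {\<theta> \<in> simplex_of_size u. \<forall>i\<in>I. t \<le> \<theta> $ i} = 0"
    unfolding hausdorff_measure_singleton[OF \<open>0 < CARD('n) - 1\<close>] by simp
  moreover have "max 0 (1 - real (card I) * t / u) = 0"
    using False \<open>0 < u\<close> by (simp add: field_simps)
  ultimately show ?thesis
    using \<open>0 < CARD('n) - 1\<close> by (simp add: zero_power)
qed

section \<open>Inclusion-exclusion\<close>

lemma sum_Pow_card_binomial: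
  fixes h :: "nat \<Rightarrow> 'b::comm_semiring_1"
  assumes "finite A"
  shows "(\<Sum>B\<in>Pow A. h (card B)) = (\<Sum>k\<le>card A. of_nat (card A choose k) * h k)"
proof -
  have "(\<Sum>B\<in>Pow A. h (card B)) = (\<Sum>k\<le>card A. \<Sum>B\<in>{B \<in> Pow A. card B = k}. h (card B))"
    using assms by (intro sum.group[symmetric]) (auto intro: card_mono)
  also have "\<dots> = (\<Sum>k\<le>card A. of_nat (card A choose k) * h k)"
    using n_subsets[OF assms] by (intro sum.cong refl) (simp add: Pow_def)
  finally show ?thesis .
qed

text \<open>
  Stated for the complement of the union, because the empty index set then contributes the whole
  space and the sum needs no exception.
\<close>
lemma (in prob_space) prob_none_inclusion_exclusion:
  assumes "finite A" and X: "\<And>a. a \<in> A \<Longrightarrow> X a \<in> events"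
  shows "prob (space M - (\<Union>a\<in>A. X a))
    = (\<Sum>B\<in>Pow A. (-1) ^ card B * prob (space M \<inter> (\<Inter>a\<in>B. X a)))"
proof -
  interpret Incl_Excl "\<lambda>S. S \<in> events" prob
    by unfold_locales (auto simp: finite_measure_Union disjnt_def)
  have "prob (\<Union>a\<in>A. X a)
      = (\<Sum>B | B \<subseteq> A \<and> B \<noteq> {}. (- 1) ^ (card B + 1) * prob (\<Inter> (X ` B)))"
    by (rule restricted_indexed) (use assms in auto)
  also have "\<dots> = - (\<Sum>B\<in>Pow A - {{}}. (- 1) ^ card B * prob (space M \<inter> (\<Inter>a\<in>B. X a)))"
    unfolding sum_negf[symmetric]
  proof (rule sum.cong)
    fix B assume "B \<in> Pow A - {{}}"
    then have "(\<Inter>a\<in>B. X a) \<subseteq> space M"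
      using X sets.sets_into_space by blast
    then show "(- 1) ^ (card B + 1) * prob (\<Inter> (X ` B))
        = - ((- 1) ^ card B * prob (space M \<inter> (\<Inter>a\<in>B. X a)))"
      by (simp add: Int_absorb1)
  qed auto
  finally have "prob (\<Union>a\<in>A. X a)
    = - (\<Sum>B\<in>Pow A - {{}}. (- 1) ^ card B * prob (space M \<inter> (\<Inter>a\<in>B. X a)))" .
  moreover have "(\<Union>a\<in>A. X a) \<in> events"
    using assms by (intro sets.finite_UN) auto
  ultimately show ?thesis
    using sum.remove[of "Pow A" "{}" "\<lambda>B. (-1) ^ card B * prob (space M \<inter> (\<Inter>a\<in>B. X a))"] \<open>finite A\<close>
    by (simp add: prob_compl prob_space)
qed

section \<open>The uniform distribution on the simplex\<close>

context
  fixes M :: "'w measure" and \<Theta> :: "'w \<Rightarrow> real ^ 'n::finite" and u :: real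
  assumes prob: "prob_space M" and uniform: "uniform_on_simplex M u \<Theta>" and u: "0 < u"
begin

lemma uniform_on_simplex_measurable: "\<Theta> \<in> borel_measurable M"
  using uniform by (simp add: uniform_on_simplex_def)

interpretation law: prob_space "distr M borel \<Theta>"
  using prob_space.prob_space_distr[OF prob uniform_on_simplex_measurable] .

lemma emeasure_uniform_on_simplex:
  assumes "C \<in> sets borel" and "C \<subseteq> simplex_of_size u"
  shows "emeasure (distr M borel \<Theta>) C
    = hausdorff_measure (CARD('n) - 1) C
      / hausdorff_measure (CARD('n) - 1) (simplex_of_size u :: (real ^ 'n) set)"
  using assms uniform
  by (simp add: uniform_on_simplex_def emeasure_distr vimage_def Int_def conj_commute)

text \<open>
  The unknown measure of the simplex cancels from the ratio because it is neither \<open>0\<close> nor \<open>\<infinity>\<close>.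
\<close>
lemma uniform_on_simplex_corner:
  assumes "2 \<le> CARD('n)" and "0 \<le> t"
  shows "measure (distr M borel \<Theta>) {\<theta> \<in> simplex_of_size u. \<forall>i\<in>I. t \<le> \<theta> $ i}
    = max 0 (1 - real (card I) * t / u) ^ (CARD('n) - 1)"
proof -
  let ?H = "hausdorff_measure (CARD('n) - 1) :: (real ^ 'n) set \<Rightarrow> ennreal"
  have "closed {\<theta> :: real ^ 'n. \<theta> \<in> simplex_of_size u \<and> (\<forall>i\<in>I. t \<le> \<theta> $ i)}"
    unfolding Ball_def using closed_simplex_of_size[of u, where 'n = 'n]
    by (intro closed_Collect_conj closed_Collect_all closed_Collect_imp closed_Collect_le
        open_Collect_const continuous_intros) simp_all
  then have "emeasure (distr M borel \<Theta>) {\<theta> \<in> simplex_of_size u. \<forall>i\<in>I. t \<le> \<theta> $ i}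
      = ennreal (max 0 (1 - real (card I) * t / u) ^ (CARD('n) - 1))
        * ?H (simplex_of_size u) / ?H (simplex_of_size u)"
    using hausdorff_measure_simplex_corner[OF u assms(2,1), of I]
    by (subst emeasure_uniform_on_simplex) auto
  also have "\<dots> = ennreal (max 0 (1 - real (card I) * t / u) ^ (CARD('n) - 1))"
    using hausdorff_measure_simplex_finite[OF u, where 'n = 'n]
      hausdorff_measure_simplex_pos[OF u, where 'n = 'n]
    by (intro mult_divide_eq_ennreal) auto
  finally show ?thesis
    by (simp add: measure_def)
qed

lemma uniform_on_simplex_support:
  assumes "2 \<le> CARD('n)"
  shows "law.prob (simplex_of_size u) = 1"
  using uniform_on_simplex_corner[OF assms order_refl, of "{}"] by simp

text \<open>
  For every \<open>e > 0\<close> the level set lies in the event \<open>b \<le> \<theta> $ i\<close> and outside \<open>b + e \<le> \<theta> $ i\<close>,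
  and the probability of \<open>t \<le> \<theta> $ i\<close> is continuous in \<open>t\<close>.
\<close>
lemma uniform_on_simplex_level_null:
  assumes "2 \<le> CARD('n)" and "0 \<le> b"
  shows "law.prob {\<theta> \<in> simplex_of_size u. \<theta> $ i = b} = 0"
proof -
  let ?F = "\<lambda>t. max 0 (1 - t / u) ^ (CARD('n) - 1)"
  have [measurable]: "simplex_of_size u \<in> sets (borel :: (real ^ 'n) measure)"
    using closed_simplex_of_size by (rule borel_closed)
  have "law.prob {\<theta> \<in> simplex_of_size u. \<theta> $ i = b} \<le> ?F b - ?F (b + e)" if "0 < e" for e
  proof -
    have "law.prob {\<theta> \<in> simplex_of_size u. \<theta> $ i = b}
        + law.prob {\<theta> \<in> simplex_of_size u. \<forall>j\<in>{i}. b + e \<le> \<theta> $ j}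
        = law.prob ({\<theta> \<in> simplex_of_size u. \<theta> $ i = b}
          \<union> {\<theta> \<in> simplex_of_size u. \<forall>j\<in>{i}. b + e \<le> \<theta> $ j})"
      using \<open>0 < e\<close> by (intro law.finite_measure_Union[symmetric]) auto
    also have "\<dots> \<le> law.prob {\<theta> \<in> simplex_of_size u. \<forall>j\<in>{i}. b \<le> \<theta> $ j}"
      using \<open>0 < e\<close> by (intro law.finite_measure_mono) auto
    finally show ?thesis
      using uniform_on_simplex_corner[OF assms(1), of "b + e" "{i}"]
        uniform_on_simplex_corner[OF assms(1), of "b" "{i}"] assms(2) \<open>0 < e\<close> by simp
  qed
  then have "\<forall>\<^sub>F e in at_right 0. law.prob {\<theta> \<in> simplex_of_size u. \<theta> $ i = b} \<le> ?F b - ?F (b + e)"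
    by (auto simp: eventually_at_right_field intro!: exI[of _ 1])
  moreover have "((\<lambda>e. ?F b - ?F (b + e)) \<longlongrightarrow> ?F b - ?F (b + 0)) (at_right 0)"
    using u by (intro tendsto_intros) auto
  ultimately have "law.prob {\<theta> \<in> simplex_of_size u. \<theta> $ i = b} \<le> ?F b - ?F (b + 0)"
    by (intro tendsto_lowerbound) auto
  then show ?thesis
    using measure_nonneg[of "distr M borel \<Theta>"] by (simp add: order_antisym)
qed

text \<open>
  Inclusion-exclusion over the events \<open>b \<le> \<theta> $ i\<close>. On the simplex, their joint complement is \<open>\<theta> $ i < b\<close> for
  all \<open>i\<close>; the difference to \<open>\<theta> $ i \<le> b\<close> is contained in the null level sets.
\<close>
lemma uniform_on_simplex_all_le:
  assumes "2 \<le> CARD('n)" and "0 \<le> b"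
  shows "law.prob {\<theta>. \<forall>i. \<theta> $ i \<le> b}
    = (\<Sum>k\<le>CARD('n). (-1) ^ k * real (CARD('n) choose k)
        * max 0 (1 - real k * b / u) ^ (CARD('n) - 1))"
proof -
  define S where "S = (simplex_of_size u :: (real ^ 'n) set)"
  have [measurable]: "S \<in> sets borel"
    unfolding S_def using closed_simplex_of_size by (rule borel_closed)
  define X where "X i = {\<theta> \<in> S. b \<le> \<theta> $ i}" for i
  have [measurable]: "X i \<in> sets borel" for i
    unfolding X_def by measurable
  have AE_ne: "AE \<theta> in distr M borel \<Theta>. \<theta> \<in> S \<and> (\<forall>i. \<theta> $ i \<noteq> b)"
  proof -
    have "AE \<theta> in distr M borel \<Theta>. \<theta> \<in> S"
      using uniform_on_simplex_support[OF assms(1)] unfolding S_def by (rule law.AE_prob_1)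
    moreover have "AE \<theta> in distr M borel \<Theta>. \<theta> \<notin> {\<theta> \<in> S. \<theta> $ i = b}" for i
      using uniform_on_simplex_level_null[OF assms, of i]
      by (intro AE_not_in) (simp add: null_sets_def law.emeasure_eq_measure S_def[symmetric])
    then have "AE \<theta> in distr M borel \<Theta>. \<forall>i. \<theta> \<notin> {\<theta> \<in> S. \<theta> $ i = b}"
      by (rule eventually_all_finite)
    ultimately show ?thesis
      by eventually_elim auto
  qed
  have "law.prob {\<theta>. \<forall>i. \<theta> $ i \<le> b} = law.prob (space (distr M borel \<Theta>) - (\<Union>i\<in>UNIV. X i))"
    using AE_ne by (intro law.finite_measure_eq_AE) (auto simp: X_def less_le not_le)
  also have "\<dots> = (\<Sum>B\<in>Pow UNIV. (-1) ^ card B * law.prob (space (distr M borel \<Theta>) \<inter> (\<Inter>i\<in>B. X i)))"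
    by (rule law.prob_none_inclusion_exclusion) auto
  also have "\<dots> = (\<Sum>B\<in>Pow (UNIV :: 'n set). (-1) ^ card B
      * max 0 (1 - real (card B) * b / u) ^ (CARD('n) - 1))"
  proof (rule sum.cong[OF refl])
    fix B :: "'n set"
    have "law.prob (space (distr M borel \<Theta>) \<inter> (\<Inter>i\<in>B. X i))
        = law.prob {\<theta> \<in> S. \<forall>i\<in>B. b \<le> \<theta> $ i}"
    proof (rule law.finite_measure_eq_AE)
      show "AE \<theta> in distr M borel \<Theta>. (\<theta> \<in> space (distr M borel \<Theta>) \<inter> (\<Inter>i\<in>B. X i))
          \<longleftrightarrow> (\<theta> \<in> {\<theta> \<in> S. \<forall>i\<in>B. b \<le> \<theta> $ i})"
        using AE_ne by eventually_elim (auto simp: X_def)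
      show "space (distr M borel \<Theta>) \<inter> (\<Inter>i\<in>B. X i) \<in> law.events"
        by (cases "B = {}") (auto intro!: sets.finite_INT)
    qed measurable
    then show "(-1) ^ card B * law.prob (space (distr M borel \<Theta>) \<inter> (\<Inter>i\<in>B. X i))
        = (-1) ^ card B * max 0 (1 - real (card B) * b / u) ^ (CARD('n) - 1)"
      using uniform_on_simplex_corner[OF assms, of B] by (simp add: S_def)
  qed
  also have "\<dots> = (\<Sum>k\<le>CARD('n). (-1) ^ k * real (CARD('n) choose k)
        * max 0 (1 - real k * b / u) ^ (CARD('n) - 1))"
    using sum_Pow_card_binomial[of "UNIV :: 'n set"
        "\<lambda>k. (-1) ^ k * max 0 (1 - real k * b / u) ^ (CARD('n) - 1)"]
    by (simp add: mult_ac)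
  finally show ?thesis .
qed

end

section \<open>Alternating binomial sums\<close>

text \<open>
  The sum is, up to sign, the \<open>n\<close>-th finite difference of a polynomial of degree less than \<open>n\<close>.
  The induction splits off one factor \<open>a - k * b\<close>: its part \<open>a\<close> leaves a power of smaller
  degree, and its part \<open>k\<close> is absorbed by \<open>k * (n choose k) = n * (n - 1 choose k - 1)\<close>.
\<close>
lemma alternating_binomial_sum_power_eq_0:
  fixes a b :: "'a::comm_ring_1"
  assumes "j < n"
  shows "(\<Sum>k\<le>n. (-1) ^ k * of_nat (n choose k) * (a - of_nat k * b) ^ j) = 0"
  using assms
proof (induction j arbitrary: n a)
  case 0
  then show ?case using choose_alternating_sum[of n, where ?'a = 'a] by simp
next
  case (Suc j)
  then obtain m where n: "n = Suc m" and "j < m"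
    by (cases n) auto
  let ?p = "\<lambda>k. (a - of_nat k * b) ^ j"
  have "(\<Sum>k\<le>n. (-1) ^ k * of_nat (k * (n choose k)) * ?p k)
      = (\<Sum>k\<le>m. (-1) ^ Suc k * of_nat (Suc k * (Suc m choose Suc k)) * ?p (Suc k))"
    unfolding n by (subst sum.atMost_Suc_shift) simp
  also have "\<dots> = - of_nat (Suc m)
      * (\<Sum>k\<le>m. (-1) ^ k * of_nat (m choose k) * ((a - b) - of_nat k * b) ^ j)"
    unfolding sum_distrib_left Suc_times_binomial
    by (intro sum.cong) (simp_all add: algebra_simps)
  also have "\<dots> = 0"
    using Suc.IH[OF \<open>j < m\<close>] by simp
  finally have absorbed: "(\<Sum>k\<le>n. (-1) ^ k * of_nat (k * (n choose k)) * ?p k) = 0" .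
  have "(\<Sum>k\<le>n. (-1) ^ k * of_nat (n choose k) * (a - of_nat k * b) ^ Suc j)
      = a * (\<Sum>k\<le>n. (-1) ^ k * of_nat (n choose k) * ?p k)
        - b * (\<Sum>k\<le>n. (-1) ^ k * of_nat (k * (n choose k)) * ?p k)"
    unfolding sum_distrib_left sum_subtractf[symmetric]
    by (intro sum.cong) (simp_all add: algebra_simps)
  also have "\<dots> = 0"
    using Suc.IH[of n a] \<open>Suc j < n\<close> absorbed by simp
  finally show ?case .
qed

text \<open>
  A power of the positive part of \<open>x\<close> differs from the power of \<open>x\<close> by a signed power of the
  positive part of \<open>- x\<close>. The sum without truncation vanishes, so the sum over the positive terms
  is minus the sum over the negative ones; exchanging \<open>k\<close> and \<open>n - k\<close> makes the signs agree.
\<close>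
lemma alternating_truncated_power_sum_reflect:
  fixes a b :: real
  assumes "2 \<le> n"
  shows "(\<Sum>k\<le>n. (-1) ^ k * real (n choose k) * max 0 (a - real k * b) ^ (n - 1))
    = (\<Sum>k\<le>n. (-1) ^ k * real (n choose k) * max 0 ((real n - real k) * b - a) ^ (n - 1))"
proof -
  define d where "d = n - 1"
  have "n = Suc d" "0 < d" using assms by (auto simp: d_def)
  have split: "max 0 x ^ d = x ^ d - (-1) ^ d * max 0 (- x) ^ d" for x :: real
  proof (cases "0 \<le> x")
    case False
    then have "max 0 x = 0" and "max 0 (- x) = (-1) * x" by simp_all
    then show ?thesis
      using \<open>0 < d\<close> unfolding power_mult_distrib by (simp add: zero_power flip: power_mult_distrib mult.assoc)
  qed (use \<open>0 < d\<close> in \<open>simp add: zero_power\<close>)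
  have "(\<Sum>k\<le>n. (-1) ^ k * real (n choose k) * max 0 (a - real k * b) ^ d)
      = (\<Sum>k\<le>n. (-1) ^ k * real (n choose k) * (a - real k * b) ^ d)
        - (\<Sum>k\<le>n. (-1) ^ k * real (n choose k) * ((-1) ^ d * max 0 (real k * b - a) ^ d))"
    unfolding sum_subtractf[symmetric]
    unfolding split[of "a - _"] minus_diff_eq right_diff_distrib ..
  also have "\<dots> = (\<Sum>k\<le>n. (-1) ^ n * (-1) ^ k * real (n choose k) * max 0 (real k * b - a) ^ d)"
    using alternating_binomial_sum_power_eq_0[of d n a b] \<open>n = Suc d\<close>
    by (simp add: sum_negf mult_ac)
  also have "\<dots> = (\<Sum>k\<le>n. (-1) ^ n * (-1) ^ (n - k) * real (n choose (n - k))
      * max 0 (real (n - k) * b - a) ^ d)"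
    using sum.atLeastAtMost_rev[of "\<lambda>k. (-1) ^ n * (-1) ^ k * real (n choose k)
      * max 0 (real k * b - a) ^ d" 0 n]
    by (simp add: atMost_atLeast0)
  also have "\<dots> = (\<Sum>k\<le>n. (-1) ^ k * real (n choose k) * max 0 ((real n - real k) * b - a) ^ d)"
  proof (intro sum.cong refl)
    fix k assume "k \<in> {..n}"
    then have "n + (n - k) = 2 * (n - k) + k" and "k \<le> n" by auto
    then have "(-1 :: real) ^ n * (-1) ^ (n - k) = (-1) ^ k"
      unfolding power_add[symmetric] by (simp only: power_add power_mult) simp
    with \<open>k \<le> n\<close> binomial_symmetric[OF \<open>k \<le> n\<close>]
    show "(-1) ^ n * (-1) ^ (n - k) * real (n choose (n - k)) * max 0 (real (n - k) * b - a) ^ d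
        = (-1) ^ k * real (n choose k) * max 0 ((real n - real k) * b - a) ^ d"
      by (simp add: of_nat_diff)
  qed
  finally show ?thesis unfolding d_def .
qed

text \<open>
  Cleared of denominators, the two inequalities say \<open>(n - m - 1) * b \<le> u < (n - m) * b\<close>, so \<open>m\<close>
  is the last index at which \<open>(n - m) * b\<close> still exceeds \<open>u\<close>.
\<close>
lemma ex1_number_of_terms:
  fixes n :: nat and u b :: real
  assumes "2 \<le> n" and "0 < u" and "u / real n < b" and "b \<le> u"
  shows "\<exists>!m. m \<le> n - 2 \<and> u / (real n - real m) < b \<and> b \<le> u / (real n - real m - 1)"
proof -
  define P where "P m \<longleftrightarrow> m \<le> n - 2 \<and> u < (real n - real m) * b" for m
  have "0 < b"
    using assms by (meson divide_pos_pos of_nat_0_less_iff order_less_trans pos2 less_le_trans)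
  have iff: "m \<le> n - 2 \<and> u / (real n - real m) < b \<and> b \<le> u / (real n - real m - 1)
      \<longleftrightarrow> P m \<and> (real n - real m - 1) * b \<le> u" for m
  proof (cases "m \<le> n - 2")
    case True
    then have "0 < real n - real m - 1"
      using \<open>2 \<le> n\<close> by linarith
    then show ?thesis
      using True by (simp add: P_def pos_divide_less_eq pos_le_divide_eq mult.commute)
  qed (simp add: P_def)
  have "P 0"
    using assms by (simp add: P_def pos_divide_less_eq mult.commute)
  define m where "m = (GREATEST m. P m)"
  have bound: "k \<le> n" if "P k" for k
    using that by (auto simp: P_def)
  have "P m"
    unfolding m_def using \<open>P 0\<close> bound by (rule GreatestI_nat)
  have greatest: "k \<le> m" if "P k" for k
    unfolding m_def using that bound by (rule Greatest_le_nat)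
  have "(real n - real m - 1) * b \<le> u"
  proof (cases "m = n - 2")
    case True
    then show ?thesis
      using \<open>2 \<le> n\<close> \<open>b \<le> u\<close> by (simp add: of_nat_diff)
  next
    case False
    then have "\<not> P (Suc m)" and "Suc m \<le> n - 2"
      using greatest[of "Suc m"] \<open>P m\<close> by (auto simp: P_def)
    then show ?thesis
      by (simp add: P_def algebra_simps)
  qed
  moreover have "k = m" if "P k" "(real n - real k - 1) * b \<le> u" for k
  proof (rule ccontr)
    assume "k \<noteq> m"
    then have "k < m"
      using greatest[OF \<open>P k\<close>] by simp
    then have "(real n - real m) * b \<le> (real n - real k - 1) * b"
      using \<open>0 < b\<close> by (intro mult_right_mono) auto
    with that \<open>P m\<close> show False
      by (simp add: P_def)
  qed
  ultimately show ?thesis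
    unfolding iff using \<open>P m\<close> by blast
qed

lemma alternating_truncated_sum_eq_initial_sum:
  fixes n m :: nat and u b :: real
  assumes "2 \<le> n" and "0 < b" and "m \<le> n - 2"
    and "u < (real n - real m) * b" and "(real n - real m - 1) * b \<le> u"
  shows "(\<Sum>k\<le>n. (-1) ^ k * real (n choose k) * max 0 ((real n - real k) * b - u) ^ (n - 1))
    = (\<Sum>k=0..m. real (n choose k) * (-1) ^ k * ((real n - real k) * b - u) ^ (n - 1))"
proof -
  have "max 0 ((real n - real k) * b - u) = (if k \<le> m then (real n - real k) * b - u else 0)" for k
  proof (cases "k \<le> m")
    case True
    then have "(real n - real m) * b \<le> (real n - real k) * b"
      using \<open>0 < b\<close> by (intro mult_right_mono) auto
    then show ?thesis using True assms(4) by simp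
  next
    case False
    then have "(real n - real k) * b \<le> (real n - real m - 1) * b"
      using \<open>0 < b\<close> by (intro mult_right_mono) auto
    then show ?thesis using False assms(5) by simp
  qed
  then have "(\<Sum>k\<le>n. (-1) ^ k * real (n choose k) * max 0 ((real n - real k) * b - u) ^ (n - 1))
      = (\<Sum>k\<le>n. if k \<le> m
          then real (n choose k) * (-1) ^ k * ((real n - real k) * b - u) ^ (n - 1) else 0)"
    using \<open>2 \<le> n\<close> by (intro sum.cong) (auto simp: zero_power)
  also have "\<dots> = (\<Sum>k=0..m. real (n choose k) * (-1) ^ k * ((real n - real k) * b - u) ^ (n - 1))"
    using \<open>m \<le> n - 2\<close> by (intro sum.mono_neutral_cong_right) auto
  finally show ?thesis .
qed

section \<open>The distribution of the largest coordinate\<close>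

theorem lemma5p1:
  fixes M :: "'w measure" and \<Theta> :: "'w \<Rightarrow> real ^ 'n::finite"
    and n :: nat and u b :: real
  assumes "prob_space M"
    and "n = CARD('n)" and "n \<ge> 2"
    and "u > 0"
    and "uniform_on_simplex M u \<Theta>"
    and "u / real n < b" and "b \<le> u"
  shows "(\<exists>!m::nat. m \<le> n - 2 \<and> u / (real n - real m) < b \<and> b \<le> u / (real n - real m - 1)) \<and>
    (\<forall>m::nat. m \<le> n - 2 \<and> u / (real n - real m) < b \<and> b \<le> u / (real n - real m - 1) \<longrightarrow>
      \<P>(\<omega> in M. Max (range (\<lambda>i. \<Theta> \<omega> $ i)) \<le> b) =
        1 / u ^ (n - 1) *
        (\<Sum>k=0..m. real (n choose k) * (-1) ^ k * ((real n - real k) * b - u) ^ (n - 1)))"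
proof (intro conjI allI impI)
  show "\<exists>!m. m \<le> n - 2 \<and> u / (real n - real m) < b \<and> b \<le> u / (real n - real m - 1)"
    using assms by (intro ex1_number_of_terms) auto
next
  fix m :: nat
  assume "m \<le> n - 2 \<and> u / (real n - real m) < b \<and> b \<le> u / (real n - real m - 1)"
  then have m: "m \<le> n - 2" "u / (real n - real m) < b" "b \<le> u / (real n - real m - 1)"
    by auto
  have pos: "0 < real n - real m - 1"
    using m(1) \<open>n \<ge> 2\<close> by linarith
  have "0 < u / real n"
    using \<open>u > 0\<close> \<open>n \<ge> 2\<close> by simp
  then have "0 < b"
    using \<open>u / real n < b\<close> by simp
  have "\<Theta> \<in> borel_measurable M"
    using assms(5) by (simp add: uniform_on_simplex_def)
  have "closed {\<theta> :: real ^ 'n. \<forall>i. \<theta> $ i \<le> b}"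
    by (intro closed_Collect_all closed_Collect_le continuous_intros)
  then have "measure (distr M borel \<Theta>) {\<theta>. \<forall>i. \<theta> $ i \<le> b}
      = \<P>(\<omega> in M. Max (range (\<lambda>i. \<Theta> \<omega> $ i)) \<le> b)"
    using \<open>\<Theta> \<in> borel_measurable M\<close>
    by (subst measure_distr) (auto simp: vimage_def Int_def conj_commute intro!: arg_cong[of _ _ "measure M"])
  then have "\<P>(\<omega> in M. Max (range (\<lambda>i. \<Theta> \<omega> $ i)) \<le> b)
      = (\<Sum>k\<le>n. (-1) ^ k * real (n choose k) * max 0 (1 - real k * b / u) ^ (n - 1))"
    using uniform_on_simplex_all_le[OF assms(1,5,4), of b] \<open>n = CARD('n)\<close> \<open>n \<ge> 2\<close> \<open>0 < b\<close> by simp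
  also have "\<dots> = 1 / u ^ (n - 1)
      * (\<Sum>k\<le>n. (-1) ^ k * real (n choose k) * max 0 (u - real k * b) ^ (n - 1))"
  proof -
    have "max 0 (1 - real k * b / u) = max 0 (u - real k * b) / u" for k
      using \<open>u > 0\<close> by (simp add: max_def field_simps)
    then show ?thesis
      by (simp add: sum_distrib_left power_divide)
  qed
  \<comment> \<open>Here the sum passes from the terms with \<open>k * b < u\<close> to those with \<open>(n - k) * b > u\<close>.\<close>
  also have "(\<Sum>k\<le>n. (-1) ^ k * real (n choose k) * max 0 (u - real k * b) ^ (n - 1))
      = (\<Sum>k\<le>n. (-1) ^ k * real (n choose k) * max 0 ((real n - real k) * b - u) ^ (n - 1))"
    using \<open>n \<ge> 2\<close> by (rule alternating_truncated_power_sum_reflect)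
  also have "\<dots> = (\<Sum>k=0..m. real (n choose k) * (-1) ^ k * ((real n - real k) * b - u) ^ (n - 1))"
    using m pos \<open>n \<ge> 2\<close> \<open>0 < b\<close>
    by (intro alternating_truncated_sum_eq_initial_sum)
      (auto simp: pos_divide_less_eq pos_le_divide_eq mult.commute)
  finally show "\<P>(\<omega> in M. Max (range (\<lambda>i. \<Theta> \<omega> $ i)) \<le> b) = 1 / u ^ (n - 1) *
      (\<Sum>k=0..m. real (n choose k) * (-1) ^ k * ((real n - real k) * b - u) ^ (n - 1))" .
qed

end
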